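(* Let $n\ge3$, let $\omega_0,\dots,\omega_{n-1}\in\mathbb{R}$, and consider the Kuramoto model on the ring with $n$ vertices and unit edge weights, $$\frac{d\theta_i}{dt}=\omega_i+\sin(\theta_{i+1}-\theta_i)+\sin(\theta_{i-1}-\theta_i),\qquad i\in\mathbb{Z}/n\mathbb{Z}.$$ Let $\theta^*$ be a fixed point of this system and put $\gamma_{i,i+1}=\cos(\theta^*_i-\theta^*_{i+1})$ for $i\in\mathbb{Z}/n\mathbb{Z}$. Then $\theta^*$ is stable if one of the following two conditions is met: (1) $\gamma_{i,i+1}>0$ for all $i$; (2) exactly one of the $\gamma_{i,i+1}$ is negative, the others are positive, and $$\sum_{i=0}^{n-1}\frac{1}{\cos(\theta_i^*-\theta_{i+1}^* )}<0 .$$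
   Context: All indices are taken modulo $n$. The Jacobian $J$ of the vector field at $\theta^*$ is the symmetric matrix with $J_{i,i\pm1}=\cos(\theta_i^*-\theta_{i\pm1}^* )$, all other off-diagonal entries zero, and diagonal entries such that all row sums vanish. Stable means that the dimension of the unstable manifold is zero, i.e. $J$ has no positive eigenvalues (it always has the eigenvalue $0$ with eigenvector $(1,\dots,1)^\top$). *)

theory Defs
  imports "HOL-Analysis.Derivative" "Jordan_Normal_Form.Char_Poly"
begin

text \<open>
  Vertices of the ring are the naturals below \<open>n\<close>, with neighbours taken modulo \<open>n\<close>;
  a point of \<open>n\<close>-dimensional space is a function on naturals of which only the values
  below \<open>n\<close> matter.
\<close>

definition ring_succ :: "nat \<Rightarrow> nat \<Rightarrow> nat" where
  "ring_succ n i = (i + 1) mod n"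

text \<open>Adding \<open>n - 1\<close> instead of subtracting 1 avoids truncated subtraction at vertex 0.\<close>

definition ring_pred :: "nat \<Rightarrow> nat \<Rightarrow> nat" where
  "ring_pred n i = (i + (n - 1)) mod n"

definition kuramoto_field :: "nat \<Rightarrow> (nat \<Rightarrow> real) \<Rightarrow> (nat \<Rightarrow> real) \<Rightarrow> nat \<Rightarrow> real" where
  "kuramoto_field n \<omega> \<theta> i =
     \<omega> i + sin (\<theta> (ring_succ n i) - \<theta> i) + sin (\<theta> (ring_pred n i) - \<theta> i)"

definition fixed_point :: "nat \<Rightarrow> (nat \<Rightarrow> real) \<Rightarrow> (nat \<Rightarrow> real) \<Rightarrow> bool" where
  "fixed_point n \<omega> \<theta> \<longleftrightarrow> (\<forall>i<n. kuramoto_field n \<omega> \<theta> i = 0)"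

definition edge_gamma :: "nat \<Rightarrow> (nat \<Rightarrow> real) \<Rightarrow> nat \<Rightarrow> real" where
  "edge_gamma n \<theta> i = cos (\<theta> i - \<theta> (ring_succ n i))"

definition jacobian :: "nat \<Rightarrow> (nat \<Rightarrow> real) \<Rightarrow> (nat \<Rightarrow> real) \<Rightarrow> real mat" where
  "jacobian n \<omega> \<theta> =
     Matrix.mat n n (\<lambda>(i, j). deriv (\<lambda>t. kuramoto_field n \<omega> (\<theta>(j := t)) i) (\<theta> j))"

text \<open>
  Stability is linear: the unstable manifold has dimension zero, that is, the Jacobian has no
  positive eigenvalue. The Jacobian is symmetric (\<open>jacobian_symmetric\<close> below), so real
  eigenvalues suffice.
\<close>

definition kuramoto_stable :: "nat \<Rightarrow> (nat \<Rightarrow> real) \<Rightarrow> (nat \<Rightarrow> real) \<Rightarrow> bool" where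
  "kuramoto_stable n \<omega> \<theta> \<longleftrightarrow> (\<forall>k. eigenvalue (jacobian n \<omega> \<theta>) k \<longrightarrow> k \<le> 0)"

lemma ring_succ_less: "0 < n \<Longrightarrow> ring_succ n i < n"
  by (simp add: ring_succ_def)

lemma ring_pred_less: "0 < n \<Longrightarrow> ring_pred n i < n"
  by (simp add: ring_pred_def)

lemma ring_succ_if: "i < n \<Longrightarrow> ring_succ n i = (if i = n - 1 then 0 else i + 1)"
  by (auto simp: ring_succ_def)

lemma ring_pred_if:
  assumes "i < n"
  shows "ring_pred n i = (if i = 0 then n - 1 else i - 1)"
proof (cases "i = 0")
  case True
  then show ?thesis using assms by (simp add: ring_pred_def)
next
  case False
  then have "i + (n - 1) = (i - 1) + n" using assms by simp
  moreover have "i - 1 < n" using assms by simp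
  ultimately show ?thesis using False by (simp only: ring_pred_def mod_add_self2 mod_less if_False)
qed

lemma ring_neighbours_distinct:
  assumes "3 \<le> n" "i < n"
  shows "ring_succ n i \<noteq> i" "ring_pred n i \<noteq> i" "ring_succ n i \<noteq> ring_pred n i"
  using assms by (auto simp: ring_succ_if ring_pred_if)

lemma ring_succ_eq_iff:
  assumes "i < n" "j < n"
  shows "ring_succ n i = j \<longleftrightarrow> ring_pred n j = i"
  using assms by (auto simp: ring_succ_if ring_pred_if split: if_splits)

text \<open>The partial derivatives exist, so \<^const>\<open>deriv\<close> is not applied vacuously.\<close>

lemma kuramoto_field_partial:
  assumes "3 \<le> n" "i < n"
  shows "((\<lambda>t. kuramoto_field n \<omega> (\<theta>(j := t)) i) has_field_derivative
     (if j = i then - cos (\<theta> i - \<theta> (ring_succ n i)) - cos (\<theta> i - \<theta> (ring_pred n i))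
      else if j = ring_succ n i \<or> j = ring_pred n i then cos (\<theta> i - \<theta> j) else 0)) (at (\<theta> j))"
proof -
  define s where "s = ring_succ n i"
  define p where "p = ring_pred n i"
  have d: "s \<noteq> i" "p \<noteq> i" "s \<noteq> p"
    using ring_neighbours_distinct[OF assms] by (simp_all add: s_def p_def)
  have c: "cos (\<theta> s - \<theta> i) = cos (\<theta> i - \<theta> s)" "cos (\<theta> p - \<theta> i) = cos (\<theta> i - \<theta> p)"
    using cos_minus[of "\<theta> s - \<theta> i"] cos_minus[of "\<theta> p - \<theta> i"] by simp_all
  have f: "(\<lambda>t. kuramoto_field n \<omega> (\<theta>(j := t)) i) =
      (\<lambda>t. \<omega> i + sin ((\<theta>(j := t)) s - (\<theta>(j := t)) i) + sin ((\<theta>(j := t)) p - (\<theta>(j := t)) i))"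
    by (simp only: kuramoto_field_def s_def p_def)
  have di: "((\<lambda>t. \<omega> i + sin (\<theta> s - t) + sin (\<theta> p - t)) has_field_derivative
      (- cos (\<theta> i - \<theta> s) - cos (\<theta> i - \<theta> p))) (at (\<theta> i))"
    unfolding c[symmetric] by (rule derivative_eq_intros refl | simp)+
  have ds: "((\<lambda>t. \<omega> i + sin (t - \<theta> i) + sin (\<theta> p - \<theta> i)) has_field_derivative
      cos (\<theta> i - \<theta> s)) (at (\<theta> s))"
    unfolding c[symmetric] by (rule derivative_eq_intros refl | simp)+
  have dp: "((\<lambda>t. \<omega> i + sin (\<theta> s - \<theta> i) + sin (t - \<theta> i)) has_field_derivative
      cos (\<theta> i - \<theta> p)) (at (\<theta> p))"
    unfolding c[symmetric] by (rule derivative_eq_intros refl | simp)+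
  have "j = i \<or> j = s \<or> j = p \<or> (j \<noteq> i \<and> j \<noteq> s \<and> j \<noteq> p)" by blast
  then show ?thesis
    unfolding f s_def[symmetric] p_def[symmetric] using d di ds dp by (elim disjE) simp_all
qed

lemma jacobian_carrier: "jacobian n \<omega> \<theta> \<in> carrier_mat n n"
  by (simp add: jacobian_def)

lemma jacobian_entry:
  assumes "3 \<le> n" "i < n" "j < n"
  shows "jacobian n \<omega> \<theta> $$ (i, j) =
     (if j = i then - cos (\<theta> i - \<theta> (ring_succ n i)) - cos (\<theta> i - \<theta> (ring_pred n i))
      else if j = ring_succ n i \<or> j = ring_pred n i then cos (\<theta> i - \<theta> j) else 0)"
proof -
  have "jacobian n \<omega> \<theta> $$ (i, j) = deriv (\<lambda>t. kuramoto_field n \<omega> (\<theta>(j := t)) i) (\<theta> j)"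
    using assms by (simp add: jacobian_def)
  then show ?thesis
    by (simp only: DERIV_imp_deriv[OF kuramoto_field_partial[OF assms(1,2), of \<omega> \<theta> j]])
qed

lemma jacobian_symmetric:
  assumes "3 \<le> n" "i < n" "j < n"
  shows "jacobian n \<omega> \<theta> $$ (i, j) = jacobian n \<omega> \<theta> $$ (j, i)"
proof -
  have c: "cos (\<theta> i - \<theta> j) = cos (\<theta> j - \<theta> i)"
    using cos_minus[of "\<theta> i - \<theta> j"] by simp
  have nb: "(j = ring_succ n i \<or> j = ring_pred n i) = (i = ring_succ n j \<or> i = ring_pred n j)"
    using ring_succ_eq_iff[of i n j] ring_succ_eq_iff[of j n i] assms by metis
  show ?thesis
  proof (cases "i = j")
    case False
    then show ?thesis
      using not_sym[OF False]
      by (simp only: jacobian_entry[OF assms] jacobian_entry[OF assms(1,3,2)] nb c if_False)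
  qed simp
qed

lemma jacobian_row_sum:
  assumes "3 \<le> n" "i < n"
  shows "(\<Sum>j<n. jacobian n \<omega> \<theta> $$ (i, j)) = 0"
proof -
  define s where "s = ring_succ n i"
  define p where "p = ring_pred n i"
  define J where "J j = jacobian n \<omega> \<theta> $$ (i, j)" for j
  have d: "s \<noteq> i" "p \<noteq> i" "s \<noteq> p" "s < n" "p < n"
    using ring_neighbours_distinct[OF assms] ring_succ_less[of n i] ring_pred_less[of n i] assms
    by (simp_all add: s_def p_def)
  have J: "J j = (if j = i then - cos (\<theta> i - \<theta> s) - cos (\<theta> i - \<theta> p)
      else if j = s \<or> j = p then cos (\<theta> i - \<theta> j) else 0)" if "j < n" for j
    unfolding J_def s_def p_def by (rule jacobian_entry[OF assms that])
  have "(\<Sum>j<n. J j) = (\<Sum>j\<in>{i, s, p}. J j)"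
    using assms d by (intro sum.mono_neutral_right) (auto simp: J)
  also have "\<dots> = J i + (J s + J p)"
    using d by simp
  also have "\<dots> = 0"
    using J[of i] J[of s] J[of p] assms d by simp
  finally show ?thesis
    by (simp only: J_def)
qed

end

(*
  For an eigenvector x of the Jacobian with eigenvalue c one has
  c * sum x_i^2 = - sum gamma_i d_i^2, where the increments d_i = x_(i+1) - x_i add up to 0
  around the ring. If one gamma_k is negative, then d_k = - sum_(i <> k) d_i, and the weighted
  Cauchy-Schwarz inequality bounds - gamma_k d_k^2 by the other terms of the sum as soon as
  the sum of the 1 / gamma_i is at most 0.
*)
theory Submission
  imports Defs "HOL-Analysis.Convex"
begin

lemma bij_betw_ring_succ: "bij_betw (ring_succ n) {..<n} {..<n}"
proof (rule bij_betw_byWitness[where f' = "ring_pred n"])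
  show "\<forall>i\<in>{..<n}. ring_pred n (ring_succ n i) = i"
    by (auto simp: ring_succ_less ring_succ_eq_iff[symmetric])
  show "\<forall>i\<in>{..<n}. ring_succ n (ring_pred n i) = i"
    by (auto simp: ring_pred_less ring_succ_eq_iff)
qed (auto intro: ring_succ_less ring_pred_less)

text \<open>Serves two purposes: moving edge terms from one endpoint to the other, and telescoping
  the increments around the ring.\<close>

lemma sum_ring_succ: "(\<Sum>i<n. f (ring_succ n i)) = (\<Sum>i<n. f i)"
  by (rule sum.reindex_bij_betw[OF bij_betw_ring_succ])

lemma ring_pred_succ: "i < n \<Longrightarrow> ring_pred n (ring_succ n i) = i"
  using ring_succ_eq_iff[of i n "ring_succ n i"] ring_succ_less[of n i] by simp

text \<open>Edge \<open>i\<close> joins \<open>i\<close> to its successor, so the edge back to the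
  predecessor carries the index \<open>ring_pred n i\<close>; evenness of the cosine makes the
  orientation irrelevant.\<close>

lemma edge_gamma_ring_pred:
  assumes "i < n"
  shows "edge_gamma n \<theta> (ring_pred n i) = cos (\<theta> i - \<theta> (ring_pred n i))"
proof -
  have "ring_succ n (ring_pred n i) = i"
    using assms by (simp add: ring_succ_eq_iff ring_pred_less)
  then show ?thesis
    using cos_minus[of "\<theta> i - \<theta> (ring_pred n i)"] by (simp add: edge_gamma_def)
qed

text \<open>Each diagonal entry is minus the sum of the two incident edge weights, so the Jacobian
  acts as the negative of the weighted Laplacian of the cycle.\<close>

lemma jacobian_apply:
  assumes "3 \<le> n" "i < n"
  shows "(\<Sum>j<n. jacobian n \<omega> \<theta> $$ (i, j) * x j) =
    edge_gamma n \<theta> i * (x (ring_succ n i) - x i)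
    + edge_gamma n \<theta> (ring_pred n i) * (x (ring_pred n i) - x i)"
proof -
  define s where "s = ring_succ n i"
  define p where "p = ring_pred n i"
  define J where "J j = jacobian n \<omega> \<theta> $$ (i, j)" for j
  have d: "s \<noteq> i" "p \<noteq> i" "s \<noteq> p" "s < n" "p < n"
    using ring_neighbours_distinct[OF assms] ring_succ_less[of n i] ring_pred_less[of n i] assms
    by (simp_all add: s_def p_def)
  have J: "J j = (if j = i then - cos (\<theta> i - \<theta> s) - cos (\<theta> i - \<theta> p)
      else if j = s \<or> j = p then cos (\<theta> i - \<theta> j) else 0)" if "j < n" for j
    unfolding J_def s_def p_def by (rule jacobian_entry[OF assms that])
  have g: "edge_gamma n \<theta> i = cos (\<theta> i - \<theta> s)" "edge_gamma n \<theta> p = cos (\<theta> i - \<theta> p)"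
    using edge_gamma_ring_pred[OF assms(2)] by (simp_all add: edge_gamma_def s_def p_def)
  \<comment> \<open>For \<open>3 \<le> n\<close> the vertices \<open>i\<close>, \<open>s\<close>,
    \<open>p\<close> are distinct, so no two entries of the row coincide.\<close>
  have "(\<Sum>j<n. J j * x j) = (\<Sum>j\<in>{i, s, p}. J j * x j)"
    using assms d by (intro sum.mono_neutral_right) (auto simp: J)
  also have "\<dots> = J i * x i + (J s * x s + J p * x p)"
    using d by simp
  also have "\<dots> = edge_gamma n \<theta> i * (x s - x i) + edge_gamma n \<theta> p * (x p - x i)"
    using assms d by (simp add: J[of i] J[of s] J[of p] g) (simp add: algebra_simps)
  finally show ?thesis
    by (simp only: J_def s_def p_def)
qed

text \<open>Summation by parts: every edge contributes once from each endpoint. Shifting the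
  predecessor sum by \<open>ring_succ\<close> brings both contributions to the same index, where
  they combine to minus a weighted square.\<close>

lemma jacobian_quadratic_form:
  assumes "3 \<le> n"
  shows "(\<Sum>i<n. x i * (\<Sum>j<n. jacobian n \<omega> \<theta> $$ (i, j) * x j)) =
    - (\<Sum>i<n. edge_gamma n \<theta> i * (x (ring_succ n i) - x i)\<^sup>2)"
proof -
  let ?g = "edge_gamma n \<theta>" and ?s = "ring_succ n" and ?p = "ring_pred n"
  have "(\<Sum>i<n. x i * (\<Sum>j<n. jacobian n \<omega> \<theta> $$ (i, j) * x j)) =
      (\<Sum>i<n. x i * (?g i * (x (?s i) - x i))) + (\<Sum>i<n. x i * (?g (?p i) * (x (?p i) - x i)))"
    using assms by (simp add: jacobian_apply distrib_left sum.distrib)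
  also have "(\<Sum>i<n. x i * (?g (?p i) * (x (?p i) - x i))) =
      (\<Sum>i<n. x (?s i) * (?g i * (x i - x (?s i))))"
    by (subst sum_ring_succ[symmetric]) (simp add: ring_pred_succ)
  also have "(\<Sum>i<n. x i * (?g i * (x (?s i) - x i))) + \<dots> =
      - (\<Sum>i<n. ?g i * (x (?s i) - x i)\<^sup>2)"
    unfolding sum.distrib[symmetric] sum_negf[symmetric]
    by (intro sum.cong) (simp_all add: power2_eq_square algebra_simps)
  finally show ?thesis .
qed

lemma kuramoto_stableI:
  assumes "3 \<le> n"
    and nonneg: "\<And>x. 0 \<le> (\<Sum>i<n. edge_gamma n \<theta> i * (x (ring_succ n i) - x i)\<^sup>2)"
  shows "kuramoto_stable n \<omega> \<theta>"
  unfolding kuramoto_stable_def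
proof (intro allI impI)
  fix k
  assume "eigenvalue (jacobian n \<omega> \<theta>) k"
  then obtain v where v: "v \<in> carrier_vec n" "v \<noteq> 0\<^sub>v n"
      and ev: "jacobian n \<omega> \<theta> *\<^sub>v v = k \<cdot>\<^sub>v v"
    using jacobian_carrier[of n \<omega> \<theta>] by (auto simp: eigenvalue_def eigenvector_def)
  define x where "x = vec_index v"
  have row: "(\<Sum>j<n. jacobian n \<omega> \<theta> $$ (i, j) * x j) = k * x i" if "i < n" for i
  proof -
    have "vec_index (jacobian n \<omega> \<theta> *\<^sub>v v) i = k * x i"
      using ev v that by (simp add: x_def)
    then show ?thesis
      using v that jacobian_carrier[of n \<omega> \<theta>]
      by (simp add: x_def scalar_prod_def lessThan_atLeast0)
  qed
  have "k * (\<Sum>i<n. (x i)\<^sup>2) = (\<Sum>i<n. x i * (\<Sum>j<n. jacobian n \<omega> \<theta> $$ (i, j) * x j))"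
    by (simp add: row sum_distrib_left power2_eq_square mult.left_commute)
  also have "\<dots> \<le> 0"
    using nonneg[of x] by (simp add: jacobian_quadratic_form[OF assms(1)])
  finally have le: "k * (\<Sum>i<n. (x i)\<^sup>2) \<le> 0" .
  \<comment> \<open>An eigenvector is nonzero, so its squared norm is positive and can be cancelled
    from \<open>le\<close>.\<close>
  obtain i where "i < n" "x i \<noteq> 0"
    using v by (auto simp: x_def vec_eq_iff)
  then have "0 < (\<Sum>i<n. (x i)\<^sup>2)"
    by (intro sum_pos2[of _ i]) auto
  then show "k \<le> 0"
    using le by (simp add: mult_le_0_iff)
qed

text \<open>Positivity of the weights allows splitting \<open>d i\<close> into
  \<open>sqrt (g i) * d i\<close> and \<open>1 / sqrt (g i)\<close>, to which the unweighted
  inequality applies.\<close>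

lemma weighted_Cauchy_Schwarz_sum:
  fixes g d :: "'a \<Rightarrow> real"
  assumes "\<And>i. i \<in> A \<Longrightarrow> 0 < g i"
  shows "(\<Sum>i\<in>A. d i)\<^sup>2 \<le> (\<Sum>i\<in>A. g i * (d i)\<^sup>2) * (\<Sum>i\<in>A. 1 / g i)"
proof -
  have "(\<Sum>i\<in>A. d i) = (\<Sum>i\<in>A. (sqrt (g i) * d i) * (1 / sqrt (g i)))"
    using assms by (intro sum.cong) (auto simp: less_imp_neq[symmetric])
  also have "\<dots>\<^sup>2 \<le> (\<Sum>i\<in>A. (sqrt (g i) * d i)\<^sup>2) * (\<Sum>i\<in>A. (1 / sqrt (g i))\<^sup>2)"
    by (rule Cauchy_Schwarz_ineq_sum)
  also have "\<dots> = (\<Sum>i\<in>A. g i * (d i)\<^sup>2) * (\<Sum>i\<in>A. 1 / g i)"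
    using assms by (simp add: power_mult_distrib power_divide less_imp_le)
  finally show ?thesis .
qed

text \<open>Stated for an arbitrary finite index set: the ring enters only through the vanishing sum
  of the increments.\<close>

lemma quadratic_form_nonneg_one_negative_weight:
  fixes g d :: "'a \<Rightarrow> real"
  assumes "finite A" "k \<in> A" "g k < 0"
    and pos: "\<And>i. i \<in> A \<Longrightarrow> i \<noteq> k \<Longrightarrow> 0 < g i"
    and inv: "(\<Sum>i\<in>A. 1 / g i) \<le> 0"
    and zero: "(\<Sum>i\<in>A. d i) = 0"
  shows "0 \<le> (\<Sum>i\<in>A. g i * (d i)\<^sup>2)"
proof -
  let ?B = "A - {k}"
  define Q where "Q = (\<Sum>i\<in>?B. g i * (d i)\<^sup>2)"
  define S where "S = (\<Sum>i\<in>?B. 1 / g i)"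
  have Q: "0 \<le> Q"
    unfolding Q_def using pos by (intro sum_nonneg) (auto simp: less_imp_le)
  have "d k = - (\<Sum>i\<in>?B. d i)"
    using zero assms(1,2) by (simp add: sum.remove)
  then have CS: "(d k)\<^sup>2 \<le> Q * S"
    using weighted_Cauchy_Schwarz_sum[of ?B g d] pos by (simp add: Q_def S_def)
  \<comment> \<open>Moving the negative term \<open>1 / g k\<close> to the other side turns
    \<open>inv\<close> into an upper bound for \<open>S\<close>.\<close>
  have "S \<le> 1 / (- g k)"
    using inv assms(1,2) by (simp add: S_def sum.remove)
  then have "- g k * S \<le> 1"
    using \<open>g k < 0\<close> by (simp add: field_simps)
  then have "Q * (- g k * S) \<le> Q"
    using Q mult_left_le by blast
  moreover have "- g k * (d k)\<^sup>2 \<le> - g k * (Q * S)"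
    using CS \<open>g k < 0\<close> by (intro mult_left_mono) auto
  \<comment> \<open>With |g k| = - g k, the chain |g k| * (d k)^2 \<le> |g k| * Q * S \<le> Q shows
    that the positive terms absorb the negative one.\<close>
  ultimately have "0 \<le> g k * (d k)\<^sup>2 + Q"
    by (simp add: algebra_simps)
  then show ?thesis
    using assms(1,2) by (simp add: Q_def sum.remove)
qed

theorem mainTheorem5:
  fixes n :: nat and \<omega> \<theta> :: "nat \<Rightarrow> real"
  assumes "3 \<le> n"
    and "fixed_point n \<omega> \<theta>"
    and "(\<forall>i<n. edge_gamma n \<theta> i > 0)
       \<or> ((\<exists>k<n. edge_gamma n \<theta> k < 0 \<and> (\<forall>i<n. i \<noteq> k \<longrightarrow> edge_gamma n \<theta> i > 0))
          \<and> (\<Sum>i<n. 1 / cos (\<theta> i - \<theta> (ring_succ n i))) < 0)"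
  shows "kuramoto_stable n \<omega> \<theta>"
proof (rule kuramoto_stableI[OF assms(1)])
  fix x :: "nat \<Rightarrow> real"
  show "0 \<le> (\<Sum>i<n. edge_gamma n \<theta> i * (x (ring_succ n i) - x i)\<^sup>2)"
    using assms(3)
  proof (elim disjE conjE exE)
    assume "\<forall>i<n. edge_gamma n \<theta> i > 0"
    then show ?thesis
      by (intro sum_nonneg) (auto simp: less_imp_le)
  next
    fix k
    assume k: "k < n" "edge_gamma n \<theta> k < 0" "\<forall>i<n. i \<noteq> k \<longrightarrow> edge_gamma n \<theta> i > 0"
      and inv: "(\<Sum>i<n. 1 / cos (\<theta> i - \<theta> (ring_succ n i))) < 0"
    show ?thesis
    proof (rule quadratic_form_nonneg_one_negative_weight)
      show "(\<Sum>i<n. 1 / edge_gamma n \<theta> i) \<le> 0"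
        using inv by (simp add: edge_gamma_def)
      \<comment> \<open>The successor map permutes the vertices, so both parts of the difference
        have the same sum.\<close>
      show "(\<Sum>i<n. x (ring_succ n i) - x i) = 0"
        by (simp add: sum_subtractf sum_ring_succ)
    qed (use k in auto)
  qed
qed

end
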